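(* Let $r, d$ be fixed positive integers with $r > d+1$, and let $N$ be a positive integer. There is an integer $t = q(r,d) N - O(\sqrt{N\ln N})$ such that the following holds: for any $N$ color classes of $r$ points each in $\mathbb{R}^d$, there is a colorful partition of their union into $r$ parts that remains a Tverberg partition even if any $t$ color classes are removed.
   Context: Color classes are disjoint sets of points. A colorful partition of the union of $N$ color classes of $r$ points each is a partition into $r$ parts each containing exactly one point of each color class; it is a Tverberg partition if the convex hulls of its parts have a common point. Removing a color class means deleting all of its points from all parts. The quantity $q(r,d)$ is the minimum, over all $r\times r$ $\{0,1\}$-matrices $T$ such that every column has a nonzero entry and there are $d+1$ rows $i_1,\ldots,i_{d+1}$ such that every column has a nonzero entry in one of these rows, of the probability that a uniformly random permutation $\sigma$ of $[r]$ satisfies $T(i,\sigma(i))=1$ for some $i$. (Equivalently, it is this probability for a matrix with exactly one $1$ per column, all $1$'s in $d+1$ rows, each of which has $\lfloor r/(d+1)\rfloor$ or $\lceil r/(d+1)\rceil$ ones.) *)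

theory Defs
  imports "HOL-Analysis.Analysis" "HOL-Probability.Probability"
    "HOL-Combinatorics.Permutations" "HOL-Library.Landau_Symbols" "HOL-Library.Disjoint_Sets"
begin

definition color_classes :: "nat \<Rightarrow> nat \<Rightarrow> 'a set set \<Rightarrow> bool" where
  "color_classes N r \<F> \<longleftrightarrow>
     finite \<F> \<and> card \<F> = N \<and> disjoint \<F> \<and> (\<forall>C\<in>\<F>. finite C \<and> card C = r)"

definition colorful_partition :: "nat \<Rightarrow> 'a set set \<Rightarrow> 'a set set \<Rightarrow> bool" where
  "colorful_partition r \<F> P \<longleftrightarrow>
     partition_on (\<Union>\<F>) P \<and> card P = r \<and> (\<forall>A\<in>P. \<forall>C\<in>\<F>. \<exists>!x. x \<in> A \<inter> C)"

definition tverberg :: "'a::real_vector set set \<Rightarrow> bool" where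
  "tverberg P \<longleftrightarrow> (\<Inter>A\<in>P. convex hull A) \<noteq> {}"

(* If every color class is removed, all parts become empty; the family is then {{}} and not
   Tverberg. Otherwise the parts of a colorful partition stay nonempty and distinct. *)
definition remove_classes :: "'a set set \<Rightarrow> 'a set set \<Rightarrow> 'a set set" where
  "remove_classes S P = (\<lambda>A. A - \<Union>S) ` P"

(* Rows and columns are indexed by {..<r}; T i j is the entry in row i and column j. *)
definition zero_one_matrices :: "nat \<Rightarrow> (nat \<Rightarrow> nat \<Rightarrow> nat) set" where
  "zero_one_matrices r = {..<r} \<rightarrow>\<^sub>E ({..<r} \<rightarrow>\<^sub>E {0, 1})"

definition admissible_matrices :: "nat \<Rightarrow> nat \<Rightarrow> (nat \<Rightarrow> nat \<Rightarrow> nat) set" where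
  "admissible_matrices r d =
     {T \<in> zero_one_matrices r.
        (\<forall>j<r. \<exists>i<r. T i j \<noteq> 0) \<and>
        (\<exists>I\<subseteq>{..<r}. card I = d + 1 \<and> (\<forall>j<r. \<exists>i\<in>I. T i j \<noteq> 0))}"

definition hit_prob :: "nat \<Rightarrow> (nat \<Rightarrow> nat \<Rightarrow> nat) \<Rightarrow> real" where
  "hit_prob r T =
     measure_pmf.prob (pmf_of_set {\<sigma>. \<sigma> permutes {..<r}}) {\<sigma>. \<exists>i<r. T i (\<sigma> i) = 1}"

definition q :: "nat \<Rightarrow> nat \<Rightarrow> real" where
  "q r d = Min (hit_prob r ` admissible_matrices r d)"

(* The next two facts show that Min in the definition of q is a genuine minimum. *)
lemma finite_admissible_matrices: "finite (admissible_matrices r d)"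
proof -
  have "finite (zero_one_matrices r)"
    unfolding zero_one_matrices_def by (intro finite_PiE) auto
  then show ?thesis
    unfolding admissible_matrices_def by simp
qed

lemma admissible_matrices_nonempty:
  assumes "d + 1 \<le> r"
  shows "admissible_matrices r d \<noteq> {}"
proof -
  define T :: "nat \<Rightarrow> nat \<Rightarrow> nat" where "T = (\<lambda>i\<in>{..<r}. \<lambda>j\<in>{..<r}. 1)"
  have "T \<in> zero_one_matrices r"
    unfolding zero_one_matrices_def T_def by auto
  moreover have "\<exists>I\<subseteq>{..<r}. card I = d + 1 \<and> (\<forall>j<r. \<exists>i\<in>I. T i j \<noteq> 0)"
    using assms by (intro exI[of _ "{..<d + 1}"]) (auto simp: T_def)
  moreover have "\<forall>j<r. \<exists>i<r. T i j \<noteq> 0"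
    by (auto simp: T_def)
  ultimately show ?thesis
    unfolding admissible_matrices_def by blast
qed

end

theory Submission
  imports Defs "HOL-Probability.Hoeffding"
begin

text \<open>
  Arrange the classes independently and uniformly at random. By a separation argument, a failure
  of the Tverberg property after removing the classes in \<open>S\<close> yields affine functionals
  \<open>f\<^sub>1, \<dots>, f\<^sub>r\<close> with sum zero such that \<open>f\<^sub>i < 0\<close> on what remains of the \<open>i\<close>-th part; hence every
  class that has a point with \<open>f\<^sub>i \<ge> 0\<close> in the \<open>i\<close>-th part, for some \<open>i\<close>, lies in \<open>S\<close>. For fixed
  functionals the half-spaces \<open>f\<^sub>i \<ge> 0\<close> cover space, and by Helly's theorem \<open>d + 1\<close> of them already
  do, so each class is hit with probability at least \<open>q r d\<close>, and Hoeffding's inequality bounds the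
  probability that fewer than \<open>q r d * N - \<epsilon>\<close> classes are hit. The functionals matter only through
  the traces of \<open>r\<close> half-spaces on the \<open>r * N\<close> points; by Radon's theorem and the Sauer--Shelah lemma
  there are only polynomially many of these, so a union bound with \<open>\<epsilon>\<close> of order
  \<open>sqrt (N * ln N)\<close> finishes the proof.
\<close>

section \<open>Shattered sets and the Sauer--Shelah bound\<close>

text \<open>Pajor's form of the Sauer--Shelah lemma. In the induction a point \<open>x\<close>
  splits the family into two families on the smaller ground set; a set shattered by both of them is
  counted twice, and it pays for this because adding \<open>x\<close> to it gives another set
  shattered by the whole family.\<close>

lemma card_le_card_shattered:
  assumes "finite X" "\<F> \<subseteq> Pow X"
  shows "card \<F> \<le> card {S. S \<subseteq> X \<and> (\<lambda>A. A \<inter> S) ` \<F> = Pow S}"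
  using assms
proof (induction X arbitrary: \<F> rule: finite_induct)
  case empty
  then consider "\<F> = {}" | "\<F> = {{}}" by auto
  then show ?case
  proof cases
    case 2
    have "{S. S \<subseteq> {} \<and> (\<lambda>A. A \<inter> S) ` \<F> = Pow S} = {{}}" unfolding 2 by auto
    then have "card {S. S \<subseteq> {} \<and> (\<lambda>A. A \<inter> S) ` \<F> = Pow S} = 1"
      by simp
    then show ?thesis unfolding 2 by simp
  qed simp
next
  case (insert x X)
  define sh where "sh \<G> Y = {S. S \<subseteq> Y \<and> (\<lambda>A. A \<inter> S) ` \<G> = Pow S}" for \<G> and Y :: "'a set"
  define F1 where "F1 = {A\<in>\<F>. x \<notin> A}"
  define F2 where "F2 = (\<lambda>A. A - {x}) ` {A\<in>\<F>. x \<in> A}"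
  have F1: "F1 \<subseteq> Pow X" and F2: "F2 \<subseteq> Pow X"
    using insert.prems by (auto simp: F1_def F2_def)
  have fin: "finite \<F>" using insert.prems insert.hyps by (meson finite_Pow_iff finite_insert finite_subset)
  have finsh: "finite (sh \<G> Y)" if "finite Y" for \<G> Y
    by (rule finite_subset[of _ "Pow Y"]) (use that in \<open>auto simp: sh_def\<close>)
  have finX: "finite (sh \<G> X)" for \<G> using finsh insert.hyps(1) by blast
  have shI: "S \<in> sh \<G> Y" if "S \<subseteq> Y" "\<And>B. B \<subseteq> S \<Longrightarrow> \<exists>A\<in>\<G>. A \<inter> S = B" for S \<G> Y
  proof -
    have "Pow S \<subseteq> (\<lambda>A. A \<inter> S) ` \<G>" using that(2) by blast
    then have "(\<lambda>A. A \<inter> S) ` \<G> = Pow S" by blast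
    then show ?thesis using that(1) unfolding sh_def by blast
  qed
  have sh_sub: "S \<subseteq> Y" if "S \<in> sh \<G> Y" for S \<G> Y
    using that unfolding sh_def by blast
  have sh_ex: "\<exists>A\<in>\<G>. A \<inter> S = B" if "S \<in> sh \<G> Y" "B \<subseteq> S" for S \<G> Y B
  proof -
    have "B \<in> (\<lambda>A. A \<inter> S) ` \<G>" using that unfolding sh_def by blast
    then show ?thesis by blast
  qed
  have notin: "x \<notin> S" if "S \<in> sh \<G> X" for S \<G>
    using sh_sub[OF that] insert.hyps(2) by blast
  have ex1: "\<exists>A\<in>\<F>. x \<notin> A \<and> A \<inter> S = B" if "S \<in> sh F1 X" "B \<subseteq> S" for S B
    using sh_ex[OF that] unfolding F1_def by blast
  have ex2: "\<exists>A\<in>\<F>. x \<in> A \<and> A \<inter> S = B" if "S \<in> sh F2 X" "B \<subseteq> S" for S B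
  proof -
    from sh_ex[OF that] obtain A where "A \<in> \<F>" "x \<in> A" "(A - {x}) \<inter> S = B"
      unfolding F2_def by blast
    moreover from notin[OF that(1)] have "(A - {x}) \<inter> S = A \<inter> S" by blast
    ultimately show ?thesis by blast
  qed
  have "card F2 = card {A\<in>\<F>. x \<in> A}"
    unfolding F2_def by (intro card_image) (auto simp: inj_on_def)
  moreover have "card \<F> = card F1 + card {A\<in>\<F>. x \<in> A}"
  proof -
    have "\<F> = F1 \<union> {A\<in>\<F>. x \<in> A}" unfolding F1_def by blast
    also have "card \<dots> = card F1 + card {A\<in>\<F>. x \<in> A}"
      using fin by (intro card_Un_disjoint) (auto simp: F1_def)
    finally show ?thesis .
  qed
  ultimately have "card \<F> = card F1 + card F2" by simp
  also have "\<dots> \<le> card (sh F1 X) + card (sh F2 X)"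
    using insert.IH[OF F1] insert.IH[OF F2] by (simp add: sh_def)
  also have "\<dots> = card (sh F1 X \<union> sh F2 X) + card (sh F1 X \<inter> sh F2 X)"
    by (rule card_Un_Int[OF finX finX])
  finally have "card \<F> \<le> card (sh F1 X \<union> sh F2 X) + card (sh F1 X \<inter> sh F2 X)" .
  \<comment> \<open>The second copy of the doubly shattered sets is marked by \<open>x\<close>,
    which no set in \<open>sh F1 X\<close> or \<open>sh F2 X\<close> contains, so the two
    collections are disjoint.\<close>
  moreover have "card (sh F1 X \<inter> sh F2 X) = card (Set.insert x ` (sh F1 X \<inter> sh F2 X))"
    by (rule card_image[symmetric], rule inj_onI) (metis IntD1 insert_ident notin)
  moreover have "card (sh F1 X \<union> sh F2 X) + card (Set.insert x ` (sh F1 X \<inter> sh F2 X)) =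
      card ((sh F1 X \<union> sh F2 X) \<union> Set.insert x ` (sh F1 X \<inter> sh F2 X))"
  proof (rule card_Un_disjoint[symmetric])
    show "(sh F1 X \<union> sh F2 X) \<inter> Set.insert x ` (sh F1 X \<inter> sh F2 X) = {}"
      using notin by blast
  qed (simp_all add: finX)
  moreover have "card ((sh F1 X \<union> sh F2 X) \<union> Set.insert x ` (sh F1 X \<inter> sh F2 X)) \<le>
      card (sh \<F> (Set.insert x X))"
  proof (intro card_mono finsh)
    show "finite (Set.insert x X)" using insert.hyps by simp
    show "(sh F1 X \<union> sh F2 X) \<union> Set.insert x ` (sh F1 X \<inter> sh F2 X) \<subseteq> sh \<F> (Set.insert x X)"
    proof
      fix S assume "S \<in> (sh F1 X \<union> sh F2 X) \<union> Set.insert x ` (sh F1 X \<inter> sh F2 X)"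
      then consider "S \<in> sh F1 X" | "S \<in> sh F2 X"
        | S' where "S = Set.insert x S'" "S' \<in> sh F1 X" "S' \<in> sh F2 X" by blast
      then show "S \<in> sh \<F> (Set.insert x X)"
      proof cases
        case 1
        show ?thesis
        proof (rule shI)
          show "S \<subseteq> Set.insert x X" using sh_sub[OF 1] by blast
          show "\<exists>A\<in>\<F>. A \<inter> S = B" if "B \<subseteq> S" for B using ex1[OF 1 that] by blast
        qed
      next
        case 2
        show ?thesis
        proof (rule shI)
          show "S \<subseteq> Set.insert x X" using sh_sub[OF 2] by blast
          show "\<exists>A\<in>\<F>. A \<inter> S = B" if "B \<subseteq> S" for B using ex2[OF 2 that] by blast
        qed
      next
        \<comment> \<open>Traces containing \<open>x\<close> are supplied by \<open>F2\<close>, the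
          others by \<open>F1\<close>.\<close>
        case 3
        have "\<exists>A\<in>\<F>. A \<inter> S = B" if B: "B \<subseteq> S" for B
        proof (cases "x \<in> B")
          case True
          have "B - {x} \<subseteq> S'" using B 3 by blast
          from ex2[OF 3(3) this] obtain A where A: "A \<in> \<F>" "x \<in> A" "A \<inter> S' = B - {x}"
            by blast
          have "A \<inter> S = B" using A True 3(1) by blast
          then show ?thesis using A by blast
        next
          case False
          have "B \<subseteq> S'" using B 3 False by blast
          from ex1[OF 3(2) this] obtain A where A: "A \<in> \<F>" "x \<notin> A" "A \<inter> S' = B"
            by blast
          have "A \<inter> S = B" using A 3(1) by blast
          then show ?thesis using A by blast
        qed
        moreover have "S \<subseteq> Set.insert x X" using sh_sub[OF 3(2)] 3(1) by blast
        ultimately show ?thesis by (intro shI)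
      qed
    qed
  qed
  ultimately have "card \<F> \<le> card (sh \<F> (Set.insert x X))" by linarith
  then show ?case unfolding sh_def .
qed

text \<open>A nonempty set with at most \<open>k + 1\<close> elements arises by adding a point to
  one with at most \<open>k\<close>; the extra choice \<open>None\<close> takes care of the empty
  set. Each step thus costs a factor \<open>card X + 1\<close>.\<close>

lemma card_subsets_card_le:
  assumes "finite X"
  shows "card {S. S \<subseteq> X \<and> card S \<le> k} \<le> (card X + 1) ^ k"
proof (induction k)
  case 0
  have "{S. S \<subseteq> X \<and> card S \<le> 0} \<subseteq> {{}}"
    using assms by (auto dest: rev_finite_subset)
  from card_mono[OF _ this] show ?case by simp
next
  case (Suc k)
  let ?U = "{S. S \<subseteq> X \<and> card S \<le> k}"
  let ?f = "\<lambda>(S, y). case y of None \<Rightarrow> S | Some x \<Rightarrow> insert x S"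
  have fin: "finite ?U" by (rule finite_subset[of _ "Pow X"]) (use assms in auto)
  have "{S. S \<subseteq> X \<and> card S \<le> Suc k} \<subseteq> ?f ` (?U \<times> insert None (Some ` X))"
  proof
    fix S assume S: "S \<in> {S. S \<subseteq> X \<and> card S \<le> Suc k}"
    show "S \<in> ?f ` (?U \<times> insert None (Some ` X))"
    proof (cases "S = {}")
      case True
      then show ?thesis by (intro image_eqI[of _ _ "({}, None)"]) auto
    next
      case False
      then obtain x where x: "x \<in> S" by auto
      moreover have "finite S" using S assms rev_finite_subset[of X S] by simp
      ultimately show ?thesis using S
        by (intro image_eqI[of _ _ "(S - {x}, Some x)"]) (auto simp: card_Diff_singleton)
    qed
  qed
  then have "card {S. S \<subseteq> X \<and> card S \<le> Suc k} \<le> card (?f ` (?U \<times> insert None (Some ` X)))"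
    using fin assms by (intro card_mono) auto
  also have "\<dots> \<le> card (?U \<times> insert None (Some ` X))"
    using fin assms by (intro card_image_le) auto
  also have "\<dots> = card ?U * (card X + 1)"
    using assms by (simp add: card_cartesian_product card_image inj_on_def)
  also have "\<dots> \<le> (card X + 1) ^ k * (card X + 1)"
    using Suc.IH by (rule mult_right_mono) simp
  finally show ?case by (simp only: power_Suc2)
qed

section \<open>Traces of half-spaces on a finite point set\<close>

lemma halfspace_convex:
  fixes w :: "'a::euclidean_space"
  shows "convex {x. w \<bullet> x + c < 0}" "convex {x. 0 \<le> w \<bullet> x + c}"
proof -
  have "{x. w \<bullet> x + c < 0} = {x. w \<bullet> x < - c}" "{x. 0 \<le> w \<bullet> x + c} = {x. w \<bullet> x \<ge> - c}" by auto
  then show "convex {x. w \<bullet> x + c < 0}" "convex {x. 0 \<le> w \<bullet> x + c}"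
    by (simp_all add: convex_halfspace_lt convex_halfspace_ge)
qed

text \<open>The vector \<open>w\<close> may be zero, so that constant functionals, which the
  separation argument can produce, are covered too.\<close>

definition halfspace_traces :: "'a::euclidean_space set \<Rightarrow> 'a set set" where
  "halfspace_traces X = {X \<inter> {x. 0 \<le> w \<bullet> x + c} | w c. True}"

lemma halfspace_traces_subset: "halfspace_traces X \<subseteq> Pow X"
  by (auto simp: halfspace_traces_def)

text \<open>Half-spaces have VC dimension at most \<open>DIM('a) + 1\<close>: a larger set has a
  Radon partition into two parts with intersecting convex hulls, and no half-space contains one part
  while missing the other.\<close>

lemma card_halfspace_traces_le:
  fixes X :: "'a::euclidean_space set"
  assumes "finite X"
  shows "card (halfspace_traces X) \<le> (card X + 1) ^ (DIM('a) + 1)"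
proof -
  let ?G = "halfspace_traces X"
  have "card S \<le> DIM('a) + 1" if S: "S \<subseteq> X" "(\<lambda>A. A \<inter> S) ` ?G = Pow S" for S
  proof (rule ccontr)
    assume "\<not> ?thesis"
    moreover have "finite S" using S(1) assms by (rule finite_subset)
    ultimately have "affine_dependent S" by (intro affine_dependent_biggerset) auto
    then obtain M P where MP: "M \<inter> P = {}" "M \<subseteq> S" "P \<subseteq> S" "convex hull M \<inter> convex hull P \<noteq> {}"
      using Radon by metis
    have "M \<in> (\<lambda>A. A \<inter> S) ` ?G" unfolding S(2) using MP(2) by blast
    then obtain w c where wc: "M = X \<inter> {x. 0 \<le> w \<bullet> x + c} \<inter> S"
      unfolding halfspace_traces_def by blast
    have "convex hull M \<subseteq> {x. 0 \<le> w \<bullet> x + c}"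
    proof (intro hull_minimal halfspace_convex)
      show "M \<subseteq> {x. 0 \<le> w \<bullet> x + c}" using wc by blast
    qed
    moreover have "convex hull P \<subseteq> {x. w \<bullet> x + c < 0}"
    proof (intro hull_minimal halfspace_convex)
      show "P \<subseteq> {x. w \<bullet> x + c < 0}" using wc MP(1,3) S(1) not_le by blast
    qed
    ultimately have "\<exists>x. 0 \<le> w \<bullet> x + c \<and> w \<bullet> x + c < 0" using MP(4) by blast
    then show False by linarith
  qed
  then have "{S. S \<subseteq> X \<and> (\<lambda>A. A \<inter> S) ` ?G = Pow S} \<subseteq> {S. S \<subseteq> X \<and> card S \<le> DIM('a) + 1}"
    by auto
  then have "card {S. S \<subseteq> X \<and> (\<lambda>A. A \<inter> S) ` ?G = Pow S} \<le> card {S. S \<subseteq> X \<and> card S \<le> DIM('a) + 1}"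
    using assms by (intro card_mono) simp_all
  with card_le_card_shattered[OF assms halfspace_traces_subset]
    card_subsets_card_le[OF assms, of "DIM('a) + 1"]
  show ?thesis by linarith
qed

section \<open>Helly's theorem and separation of several convex sets\<close>

text \<open>\<open>Helly\<close> speaks of a set of sets, whereas the \<open>K i\<close> may
  coincide. A small subfamily with empty intersection is lifted to distinct indices and then padded
  to exactly \<open>DIM('a) + 1\<close> of them, which keeps the intersection empty.\<close>

lemma Helly_indexed:
  fixes K :: "'i \<Rightarrow> 'a::euclidean_space set"
  assumes fin: "finite I" and card: "DIM('a) + 1 \<le> card I"
    and conv: "\<And>i. i \<in> I \<Longrightarrow> convex (K i)" and empty: "(\<Inter>i\<in>I. K i) = {}"
  obtains J where "J \<subseteq> I" "card J = DIM('a) + 1" "(\<Inter>i\<in>J. K i) = {}"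
proof -
  have "\<exists>\<T>\<subseteq>K ` I. card \<T> \<le> DIM('a) + 1 \<and> \<Inter>\<T> = {}"
  proof (cases "card (K ` I) \<ge> DIM('a) + 1")
    case True
    show ?thesis
    proof (rule ccontr)
      assume no: "\<not> ?thesis"
      have "\<Inter>(K ` I) \<noteq> {}"
      proof (rule Helly[OF True])
        show "\<forall>s\<in>K ` I. convex s" using conv by blast
        show "\<Inter>\<T> \<noteq> {}" if "\<T> \<subseteq> K ` I" and "card \<T> = DIM('a) + 1" for \<T>
          using no that(1) eq_imp_le[OF that(2)] by blast
      qed
      then show False using empty by simp
    qed
  next
    case False
    then show ?thesis using empty by (intro exI[of _ "K ` I"]) auto
  qed
  then obtain \<T> where \<T>: "\<T> \<subseteq> K ` I" "card \<T> \<le> DIM('a) + 1" "\<Inter>\<T> = {}" by blast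
  obtain J0 where J0: "J0 \<subseteq> I" "inj_on K J0" "\<T> = K ` J0"
    using \<T>(1) by (meson subset_image_inj)
  have "card J0 \<le> DIM('a) + 1" using \<T>(2) J0 by (simp add: card_image)
  then obtain J where J: "J0 \<subseteq> J" "J \<subseteq> I" "card J = DIM('a) + 1"
    using exists_subset_between[OF _ card J0(1) fin] by blast
  have "(\<Inter>i\<in>J. K i) = {}" using J(1) \<T>(3) unfolding J0(3) by blast
  with J show thesis using that by blast
qed

text \<open>
  Let \<open>y\<close> minimise the sum of the squared distances to the \<open>K i\<close>, with closest points \<open>p i\<close>. Then \<open>y\<close>
  is the mean of the \<open>p i\<close>, so the vectors \<open>y - p i\<close> sum to zero; each of them weakly separates
  \<open>K i\<close> from \<open>p i\<close>, and averaging the gaps makes all the inequalities strict.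
\<close>

lemma strictly_separating_functionals:
  fixes K :: "'i \<Rightarrow> 'a::euclidean_space set"
  assumes fin: "finite I" and I: "I \<noteq> {}"
    and comp: "\<And>i. i \<in> I \<Longrightarrow> compact (K i)" and conv: "\<And>i. i \<in> I \<Longrightarrow> convex (K i)"
    and ne: "\<And>i. i \<in> I \<Longrightarrow> K i \<noteq> {}" and empty: "(\<Inter>i\<in>I. K i) = {}"
  obtains w :: "'i \<Rightarrow> 'a" and c :: "'i \<Rightarrow> real" where "(\<Sum>i\<in>I. w i) = 0" "(\<Sum>i\<in>I. c i) = 0"
    "\<And>i x. i \<in> I \<Longrightarrow> x \<in> K i \<Longrightarrow> w i \<bullet> x + c i < 0"
proof -
  \<comment> \<open>Compactness of \<open>Q\<close> gives a minimiser, and convexity makes the mean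
    of the closest points an admissible competitor.\<close>
  define Q where "Q = convex hull (\<Union>i\<in>I. K i)"
  define \<phi> where "\<phi> y = (\<Sum>i\<in>I. (norm (y - closest_point (K i) y))\<^sup>2)" for y
  have closed: "closed (K i)" if "i \<in> I" for i using comp[OF that] by (rule compact_imp_closed)
  have "compact Q" unfolding Q_def using fin comp by (intro compact_convex_hull compact_UN) auto
  moreover have "Q \<noteq> {}" unfolding Q_def using I ne by auto
  moreover have "continuous_on Q \<phi>"
    unfolding \<phi>_def using conv closed ne by (intro continuous_intros continuous_on_closest_point) auto
  ultimately obtain y where y: "y \<in> Q" "\<And>z. z \<in> Q \<Longrightarrow> \<phi> y \<le> \<phi> z"
    using continuous_attains_inf by metis
  define n where "n = real (card I)"
  have n: "n > 0" unfolding n_def using fin I by (simp add: card_gt_0_iff)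
  define p where "p i = closest_point (K i) y" for i
  have p: "p i \<in> K i" if "i \<in> I" for i
    unfolding p_def using closed ne that by (intro closest_point_in_set) auto
  define w where "w i = y - p i" for i
  define \<delta> where "\<delta> = (\<Sum>i\<in>I. (norm (w i))\<^sup>2) / n"
  define m where "m = (\<Sum>i\<in>I. (1 / n) *\<^sub>R p i)"
  have "m \<in> Q" unfolding m_def
  proof (rule convex_sum[OF fin])
    show "convex Q" by (simp add: Q_def)
    show "(\<Sum>i\<in>I. 1 / n) = 1" using n by (simp add: n_def)
    show "p i \<in> Q" if "i \<in> I" for i
      unfolding Q_def using p[OF that] that by (intro hull_inc) auto
  qed (use n in auto)
  have sumw: "(\<Sum>i\<in>I. w i) = n *\<^sub>R (y - m)"
    using n by (simp add: w_def sum_subtractf m_def n_def scaleR_diff_right scaleR_sum_right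
        sum_constant_scaleR del: sum_constant)
  have "\<phi> y \<le> \<phi> m" using y \<open>m \<in> Q\<close> by blast
  also have "\<dots> \<le> (\<Sum>i\<in>I. (norm (m - p i))\<^sup>2)"
    unfolding \<phi>_def using closed p
    by (intro sum_mono power_mono) (auto simp flip: dist_norm intro: closest_point_le)
  also have "\<dots> = (\<Sum>i\<in>I. (norm (w i))\<^sup>2 - 2 * (w i \<bullet> (y - m)) + (norm (y - m))\<^sup>2)"
  proof (rule sum.cong)
    fix i
    have "m - p i = w i - (y - m)" by (simp add: w_def)
    then show "(norm (m - p i))\<^sup>2 = (norm (w i))\<^sup>2 - 2 * (w i \<bullet> (y - m)) + (norm (y - m))\<^sup>2"
      by (simp only: power2_norm_eq_inner) (simp add: inner_diff_left inner_diff_right inner_commute)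
  qed simp
  also have "\<dots> = \<phi> y - 2 * ((\<Sum>i\<in>I. w i) \<bullet> (y - m)) + n * (norm (y - m))\<^sup>2"
    by (simp add: \<phi>_def p_def[symmetric] w_def[symmetric] sum.distrib sum_subtractf inner_sum_left
        sum_distrib_left n_def)
  \<comment> \<open>By \<open>sumw\<close> the linear term is twice the quadratic one with opposite
    sign, so \<open>m\<close> would beat the minimiser \<open>y\<close> unless they agree.\<close>
  also have "\<dots> = \<phi> y - n * (norm (y - m))\<^sup>2"
    by (simp add: sumw power2_norm_eq_inner)
  finally have "y = m" using n by (simp add: mult_le_0_iff)
  then have w0: "(\<Sum>i\<in>I. w i) = 0" using sumw by simp
  have "\<delta> > 0"
  proof (rule ccontr)
    assume "\<not> \<delta> > 0"
    then have "(\<Sum>i\<in>I. (norm (w i))\<^sup>2) = 0"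
      using n sum_nonneg[of I "\<lambda>i. (norm (w i))\<^sup>2"] by (auto simp: \<delta>_def zero_less_divide_iff not_less)
    then have "\<forall>i\<in>I. w i = 0" using fin by (simp add: sum_nonneg_eq_0_iff)
    then have "y \<in> (\<Inter>i\<in>I. K i)" using p by (auto simp: w_def)
    then show False using empty by simp
  qed
  \<comment> \<open>Without \<open>\<delta>\<close> the functional would be
    \<open>w i \<bullet> (x - p i)\<close>, at most zero on \<open>K i\<close>. Those constants sum
    to \<open>n * \<delta>\<close>, so subtracting their average both makes the sum vanish and makes
    the inequalities strict.\<close>
  define c where "c i = (norm (w i))\<^sup>2 - w i \<bullet> y - \<delta>" for i
  show thesis
  proof (rule that)
    show "(\<Sum>i\<in>I. w i) = 0" by (rule w0)
    show "(\<Sum>i\<in>I. c i) = 0"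
      using n w0 by (simp add: c_def sum_subtractf \<delta>_def flip: inner_sum_left n_def)
    fix i x assume i: "i \<in> I" and x: "x \<in> K i"
    have "w i \<bullet> (x - p i) \<le> 0"
      unfolding w_def p_def using conv closed i x by (intro closest_point_dot) auto
    moreover have "w i \<bullet> x + c i = w i \<bullet> (x - p i) - \<delta>"
      by (simp add: c_def power2_norm_eq_inner w_def inner_diff_left inner_diff_right inner_commute)
    ultimately show "w i \<bullet> x + c i < 0" using \<open>\<delta> > 0\<close> by simp
  qed
qed

section \<open>The probabilistic existence argument\<close>

text \<open>Choose the \<open>\<sigma> C\<close> independently from \<open>D\<close>. For each test
  \<open>h\<close> the hits are independent indicators of mean at least \<open>p\<close>, so
  Hoeffding bounds the lower tail; by \<open>small\<close> the union bound over \<open>H\<close>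
  leaves an outcome that passes every test.\<close>

lemma exists_choice_many_hits:
  fixes D :: "'b pmf" and B :: "'h \<Rightarrow> 'c \<Rightarrow> 'b set"
  assumes fin: "finite F" "F \<noteq> {}" "finite H" and "\<epsilon> \<ge> 0"
    and hit: "\<And>h C. h \<in> H \<Longrightarrow> C \<in> F \<Longrightarrow> p \<le> measure_pmf.prob D (B h C)"
    and small: "real (card H) * exp (- 2 * \<epsilon>\<^sup>2 / real (card F)) < 1"
  obtains \<sigma> where "\<And>C. C \<in> F \<Longrightarrow> \<sigma> C \<in> set_pmf D"
    "\<And>h. h \<in> H \<Longrightarrow> p * real (card F) - \<epsilon> < real (card {C\<in>F. \<sigma> C \<in> B h C})"
proof -
  define M where "M = Pi_pmf F undefined (\<lambda>_. D)"
  define X :: "'h \<Rightarrow> 'c \<Rightarrow> ('c \<Rightarrow> 'b) \<Rightarrow> real" where "X h C \<sigma> = indicator (B h C) (\<sigma> C)" for h C \<sigma>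
  define bad where "bad h = {\<sigma>. (\<Sum>C\<in>F. X h C \<sigma>) \<le> p * real (card F) - \<epsilon>}" for h
  have bad: "measure_pmf.prob M (bad h) \<le> exp (- 2 * \<epsilon>\<^sup>2 / real (card F))" if h: "h \<in> H" for h
  proof -
    interpret Hoeffding_ineq "measure_pmf M" F "X h" "\<lambda>_. 0" "\<lambda>_. 1"
      "\<Sum>C\<in>F. measure_pmf.expectation M (X h C)"
    proof unfold_locales
      show "prob_space.indep_vars (measure_pmf M) (\<lambda>_. borel) (X h) F"
        unfolding X_def M_def
        by (rule prob_space.indep_vars_compose2[OF measure_pmf.prob_space_axioms
              indep_vars_Pi_pmf[OF fin(1)]]) auto
    qed (use fin in \<open>auto simp: X_def indicator_def\<close>)
    have exp: "p \<le> measure_pmf.expectation M (X h C)" if C: "C \<in> F" for C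
    proof -
      have "measure_pmf.expectation M (X h C) =
          measure_pmf.expectation (map_pmf (\<lambda>f. f C) M) (indicator (B h C))"
        by (simp only: integral_map_pmf X_def[abs_def])
      also have "map_pmf (\<lambda>f. f C) M = D"
        unfolding M_def using fin C by (simp add: Pi_pmf_component)
      finally show ?thesis using hit[OF h C] by simp
    qed
    have "p * real (card F) \<le> (\<Sum>C\<in>F. measure_pmf.expectation M (X h C))"
      using sum_mono[of F "\<lambda>_. p", OF exp] by (simp add: mult.commute)
    then have "bad h \<subseteq> {\<sigma>\<in>space (measure_pmf M).
        (\<Sum>C\<in>F. X h C \<sigma>) \<le> (\<Sum>C\<in>F. measure_pmf.expectation M (X h C)) - \<epsilon>}"
      by (auto simp: bad_def)
    then have "measure_pmf.prob M (bad h) \<le> measure_pmf.prob M {\<sigma>\<in>space (measure_pmf M).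
        (\<Sum>C\<in>F. X h C \<sigma>) \<le> (\<Sum>C\<in>F. measure_pmf.expectation M (X h C)) - \<epsilon>}"
      by (intro measure_pmf.finite_measure_mono) auto
    also have "\<dots> \<le> exp (- 2 * \<epsilon>\<^sup>2 / real (card F))"
      using Hoeffding_ineq_le[OF \<open>\<epsilon> \<ge> 0\<close>] assms(1,2) by (simp add: card_gt_0_iff)
    finally show ?thesis .
  qed
  have "measure_pmf.prob M (\<Union>h\<in>H. bad h) \<le> (\<Sum>h\<in>H. measure_pmf.prob M (bad h))"
    using fin by (intro measure_pmf.finite_measure_subadditive_finite) auto
  also have "\<dots> \<le> real (card H) * exp (- 2 * \<epsilon>\<^sup>2 / real (card F))"
    using sum_mono[OF bad, of H "\<lambda>h. h"] by simp
  finally have "measure_pmf.prob M (\<Union>h\<in>H. bad h) < 1" using small by simp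
  \<comment> \<open>The good outcome must lie in the support of \<open>M\<close>, since only there
    is every \<open>\<sigma> C\<close> a value that \<open>D\<close> can take.\<close>
  moreover have "measure_pmf.prob M (\<Union>h\<in>H. bad h) = 1" if "set_pmf M \<subseteq> (\<Union>h\<in>H. bad h)"
    using that by (subst measure_pmf.prob_eq_1) (auto simp: AE_measure_pmf_iff)
  ultimately have "\<not> set_pmf M \<subseteq> (\<Union>h\<in>H. bad h)" by auto
  then obtain \<sigma> where \<sigma>: "\<sigma> \<in> set_pmf M" "\<And>h. h \<in> H \<Longrightarrow> \<sigma> \<notin> bad h" by auto
  show thesis
  proof (rule that)
    show "\<sigma> C \<in> set_pmf D" if "C \<in> F" for C
      using \<sigma>(1) fin that by (auto simp: M_def set_Pi_pmf PiE_dflt_def)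
    show "p * real (card F) - \<epsilon> < real (card {C\<in>F. \<sigma> C \<in> B h C})" if "h \<in> H" for h
    proof -
      have "(\<Sum>C\<in>F. X h C \<sigma>) = real (card {C\<in>F. \<sigma> C \<in> B h C})"
        using fin by (simp add: X_def indicator_def sum.If_cases Collect_conj_eq Int_commute)
      then show ?thesis using \<sigma>(2)[OF that] by (simp add: bad_def)
    qed
  qed
qed

section \<open>The hitting probability of a random permutation\<close>

lemma q_le_hit_prob: "T \<in> admissible_matrices r d \<Longrightarrow> q r d \<le> hit_prob r T"
  unfolding q_def by (intro Min_le) (auto simp: finite_admissible_matrices)

lemma q_le_one:
  assumes "d + 1 \<le> r"
  shows "q r d \<le> 1"
proof -
  obtain T where "T \<in> admissible_matrices r d" using admissible_matrices_nonempty[OF assms] by blast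
  from q_le_hit_prob[OF this] show ?thesis
    unfolding hit_prob_def using measure_pmf.prob_le_1 order_trans by blast
qed

lemma set_pmf_permutations:
  "set_pmf (pmf_of_set {\<sigma>. \<sigma> permutes {..<r}}) = {\<sigma>. \<sigma> permutes {..<r::nat}}"
proof (rule set_pmf_of_set)
  show "{\<sigma>. \<sigma> permutes {..<r}} \<noteq> {}" using permutes_id by blast
qed (simp add: finite_permutations)

text \<open>The 0-1 matrix of \<open>R\<close> is admissible with \<open>J\<close> as its covering
  rows. Its hitting event can differ from that of \<open>R\<close> only outside the permutations of
  \<open>{..<r}\<close>, hence the comparison almost everywhere.\<close>

lemma q_le_prob_hit:
  assumes J: "J \<subseteq> {..<r}" "card J = d + 1" and cover: "\<And>j. j < r \<Longrightarrow> \<exists>i\<in>J. R i j"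
  shows "q r d \<le> measure_pmf.prob (pmf_of_set {\<sigma>. \<sigma> permutes {..<r}}) {\<sigma>. \<exists>i<r. R i (\<sigma> i)}"
proof -
  define T :: "nat \<Rightarrow> nat \<Rightarrow> nat" where "T = (\<lambda>i\<in>{..<r}. \<lambda>j\<in>{..<r}. if R i j then 1 else 0)"
  have T: "T i j \<noteq> 0 \<longleftrightarrow> R i j" "T i j = 1 \<longleftrightarrow> R i j" if "i < r" "j < r" for i j
    using that by (auto simp: T_def)
  have "T \<in> admissible_matrices r d"
    unfolding admissible_matrices_def mem_Collect_eq
  proof (intro conjI exI[of _ J] allI impI)
    show "T \<in> zero_one_matrices r" by (auto simp: zero_one_matrices_def T_def)
    show "\<exists>i\<in>J. T i j \<noteq> 0" if "j < r" for j
      using cover[OF that] J(1) T(1) that by blast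
    then show "\<exists>i<r. T i j \<noteq> 0" if "j < r" for j
      using J(1) that by blast
  qed (use J in auto)
  then have "q r d \<le> hit_prob r T" by (rule q_le_hit_prob)
  also have "\<dots> = measure_pmf.prob (pmf_of_set {\<sigma>. \<sigma> permutes {..<r}}) {\<sigma>. \<exists>i<r. R i (\<sigma> i)}"
    unfolding hit_prob_def
  proof (intro measure_pmf.finite_measure_eq_AE AE_pmfI)
    fix \<sigma> assume "\<sigma> \<in> set_pmf (pmf_of_set {\<sigma>. \<sigma> permutes {..<r}})"
    then have "\<sigma> permutes {..<r}" by (simp only: set_pmf_permutations mem_Collect_eq)
    then have "\<sigma> i < r" if "i < r" for i using that permutes_in_image by fastforce
    then show "\<sigma> \<in> {\<sigma>. \<exists>i<r. T i (\<sigma> i) = 1} \<longleftrightarrow> \<sigma> \<in> {\<sigma>. \<exists>i<r. R i (\<sigma> i)}"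
      using T(2) by auto
  qed auto
  finally show ?thesis .
qed

section \<open>From arrangements of the classes to tolerant partitions\<close>

text \<open>A point determines its class by disjointness and then its index by bijectivity, so the
  parts are disjoint. As \<open>F\<close> is nonempty, they are nonempty and therefore
  distinct.\<close>

lemma colorful_partition_of_bijections:
  assumes F: "color_classes N r F" and ne: "F \<noteq> {}"
    and b: "\<And>C. C \<in> F \<Longrightarrow> bij_betw (b C) {..<r} C"
  shows "colorful_partition r F ((\<lambda>i. (\<lambda>C. b C i) ` F) ` {..<r})"
proof -
  let ?A = "\<lambda>i. (\<lambda>C. b C i) ` F"
  have mem: "b C i \<in> C" if "C \<in> F" "i < r" for C i
    using b[OF that(1)] that(2) by (auto simp: bij_betw_def)
  have same_class: "C = C'" if "C \<in> F" "C' \<in> F" "x \<in> C" "x \<in> C'" for C C' x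
    using F that unfolding color_classes_def disjoint_def by blast
  have index: "i = j" if "C \<in> F" "i < r" "j < r" "b C i = b C j" for C i j
    using b[OF that(1)] that(2-) by (auto simp: bij_betw_def inj_on_def)
  have same: "C = C' \<and> i = j" if "C \<in> F" "C' \<in> F" "i < r" "j < r" "b C i = b C' j" for C C' i j
    using same_class[OF that(1,2)] mem that index by metis
  have disj: "?A i \<inter> ?A j = {}" if "i < r" "j < r" "i \<noteq> j" for i j
    using same that by blast
  have inj: "inj_on ?A {..<r}"
  proof (rule inj_onI, rule ccontr)
    fix i j assume "i \<in> {..<r}" "j \<in> {..<r}" "?A i = ?A j" "i \<noteq> j"
    then show False using disj[of i j] ne by auto
  qed
  have "partition_on (\<Union>F) (?A ` {..<r})"
  proof (rule partition_onI)
    show "\<Union> (?A ` {..<r}) = \<Union>F"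
    proof
      show "\<Union> (?A ` {..<r}) \<subseteq> \<Union>F" using mem by blast
      show "\<Union>F \<subseteq> \<Union> (?A ` {..<r})"
      proof
        fix x assume "x \<in> \<Union>F"
        then obtain C where C: "C \<in> F" "x \<in> C" by blast
        then have "x \<in> b C ` {..<r}" using b[OF C(1)] by (simp add: bij_betw_def)
        then show "x \<in> \<Union> (?A ` {..<r})" using C(1) by blast
      qed
    qed
    show "disjnt p p'" if "p \<in> ?A ` {..<r}" "p' \<in> ?A ` {..<r}" "p \<noteq> p'" for p p'
    proof -
      obtain i j where ij: "i < r" "j < r" "p = ?A i" "p' = ?A j" using \<open>p \<in> _\<close> \<open>p' \<in> _\<close> by blast
      then have "i \<noteq> j" using \<open>p \<noteq> p'\<close> by blast
      then show ?thesis using disj ij unfolding disjnt_def by blast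
    qed
    show "{} \<notin> ?A ` {..<r}" using ne by blast
  qed
  moreover have "card (?A ` {..<r}) = r" using inj by (simp add: card_image)
  moreover have "\<exists>!x. x \<in> ?A i \<inter> C" if "i < r" "C \<in> F" for i C
  proof (rule ex1I)
    show "b C i \<in> ?A i \<inter> C" using that mem by blast
    fix x assume "x \<in> ?A i \<inter> C"
    then obtain C' where "C' \<in> F" "x = b C' i" "x \<in> C" by blast
    then show "x = b C i" using same_class[of C' C x] mem that by blast
  qed
  ultimately show ?thesis unfolding colorful_partition_def by blast
qed

text \<open>The separating functionals depend on the arrangement and on \<open>S\<close>, but the
  tests \<open>\<H>\<close> they induce come from a finite list fixed by \<open>X\<close> alone. One
  arrangement that passes all tests therefore serves every \<open>S\<close>.\<close>

lemma exists_tolerant_colorful_partition: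
  fixes F :: "'a::euclidean_space set set"
  assumes F: "color_classes N r F" and N: "N \<ge> 1" and r: "DIM('a) + 1 \<le> r" and \<epsilon>: "\<epsilon> \<ge> 0"
    and small: "real ((r * N + 1) ^ ((DIM('a) + 1) * r)) * exp (- 2 * \<epsilon>\<^sup>2 / real N) < 1"
  shows "\<exists>P. colorful_partition r F P \<and>
    (\<forall>S\<subseteq>F. real (card S) \<le> q r DIM('a) * real N - \<epsilon> \<longrightarrow> tverberg (remove_classes S P))"
proof -
  define X where "X = \<Union>F"
  have finF: "finite F" and cardF: "card F = N" and ne: "F \<noteq> {}"
    and finC: "\<And>C. C \<in> F \<Longrightarrow> finite C" and cardC: "\<And>C. C \<in> F \<Longrightarrow> card C = r"
    using F N by (auto simp: color_classes_def)
  have finX: "finite X" unfolding X_def using finF finC by blast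
  have cardX: "card X = r * N"
    unfolding X_def using F finF finC cardC cardF
    by (subst card_Union_disjoint) (auto simp: color_classes_def mult.commute)
  have "\<exists>f. bij_betw f {..<r} C" if "C \<in> F" for C
    using finC[OF that] cardC[OF that] ex_bij_betw_nat_finite[of C] by (auto simp: lessThan_atLeast0)
  then obtain e where e: "\<And>C. C \<in> F \<Longrightarrow> bij_betw (e C) {..<r} C" by metis
  define D where "D = pmf_of_set {\<sigma>. \<sigma> permutes {..<r}}"
  define B where "B Z C = {\<sigma>. \<exists>i<r. e C (\<sigma> i) \<in> Z i}" for Z :: "nat \<Rightarrow> 'a set" and C
  define \<H> where "\<H> = {Z \<in> {..<r} \<rightarrow>\<^sub>E halfspace_traces X.
      \<exists>J\<subseteq>{..<r}. card J = DIM('a) + 1 \<and> (\<forall>x\<in>X. \<exists>i\<in>J. x \<in> Z i)}"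
  have fintr: "finite (halfspace_traces X)"
    using halfspace_traces_subset finX by (rule finite_subset[OF _ iffD2[OF finite_Pow_iff]])
  have fin\<H>: "finite \<H>"
    unfolding \<H>_def using fintr by (simp add: finite_PiE)
  have "card \<H> \<le> card ({..<r} \<rightarrow>\<^sub>E halfspace_traces X)"
    unfolding \<H>_def using fintr by (intro card_mono) (auto simp: finite_PiE)
  also have "\<dots> = card (halfspace_traces X) ^ r" by (simp add: card_PiE)
  also have "\<dots> \<le> ((r * N + 1) ^ (DIM('a) + 1)) ^ r"
    using card_halfspace_traces_le[OF finX] by (intro power_mono) (auto simp: cardX)
  also have "\<dots> = (r * N + 1) ^ ((DIM('a) + 1) * r)" by (rule power_mult[symmetric])
  finally have card\<H>: "real (card \<H>) \<le> real ((r * N + 1) ^ ((DIM('a) + 1) * r))"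
    by (rule of_nat_mono)
  have "real (card \<H>) * exp (- 2 * \<epsilon>\<^sup>2 / real (card F)) \<le>
      real ((r * N + 1) ^ ((DIM('a) + 1) * r)) * exp (- 2 * \<epsilon>\<^sup>2 / real N)"
    unfolding cardF using card\<H> by (rule mult_right_mono) simp
  then have lt1: "real (card \<H>) * exp (- 2 * \<epsilon>\<^sup>2 / real (card F)) < 1" using small by (rule le_less_trans)
  have hit: "q r DIM('a) \<le> measure_pmf.prob D (B Z C)" if "Z \<in> \<H>" "C \<in> F" for Z C
  proof -
    obtain J where J: "J \<subseteq> {..<r}" "card J = DIM('a) + 1" "\<forall>x\<in>X. \<exists>i\<in>J. x \<in> Z i"
      using \<open>Z \<in> \<H>\<close> unfolding \<H>_def by blast
    show ?thesis unfolding D_def B_def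
    proof (rule q_le_prob_hit[OF J(1,2)])
      fix j assume "j < r"
      then have "e C j \<in> X" using e[OF \<open>C \<in> F\<close>] \<open>C \<in> F\<close> by (auto simp: bij_betw_def X_def)
      then show "\<exists>i\<in>J. e C j \<in> Z i" using J(3) by blast
    qed
  qed
  obtain \<sigma> where \<sigma>: "\<And>C. C \<in> F \<Longrightarrow> \<sigma> C \<in> set_pmf D"
    and many: "\<And>Z. Z \<in> \<H> \<Longrightarrow> q r DIM('a) * real (card F) - \<epsilon> < real (card {C\<in>F. \<sigma> C \<in> B Z C})"
    using exists_choice_many_hits[where B = B and F = F and H = \<H> and D = D,
        OF finF ne fin\<H> \<epsilon> hit lt1] by blast
  define b where "b C = e C \<circ> \<sigma> C" for C
  have b: "bij_betw (b C) {..<r} C" if "C \<in> F" for C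
  proof -
    have "\<sigma> C permutes {..<r}" using \<sigma>[OF that] by (simp add: D_def set_pmf_permutations)
    then have "bij_betw (\<sigma> C) {..<r} {..<r}" by (rule permutes_imp_bij)
    then show ?thesis unfolding b_def using e[OF that] by (rule bij_betw_trans)
  qed
  define A where "A i = (\<lambda>C. b C i) ` F" for i
  have hits: "q r DIM('a) * real N - \<epsilon> < real (card {C\<in>F. \<exists>i<r. 0 \<le> w i \<bullet> b C i + c i})"
    if w: "(\<Sum>i<r. w i) = 0" and c: "(\<Sum>i<r. c i) = 0" for w :: "nat \<Rightarrow> 'a" and c
  proof -
    \<comment> \<open>Functionals with sum zero cannot all be negative at a point. Helly then leaves
      \<open>DIM('a) + 1\<close> open half-spaces with empty intersection, so their complements
      cover the space and the traces form a test in \<open>\<H>\<close>.\<close>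
    have "(\<Inter>i<r. {x. w i \<bullet> x + c i < 0}) = {}"
    proof (rule ccontr)
      assume "\<not> ?thesis"
      then obtain x where "\<And>i. i < r \<Longrightarrow> w i \<bullet> x + c i < 0" by auto
      moreover have "{..<r} \<noteq> {}" using r by (auto simp: lessThan_empty_iff)
      ultimately have "(\<Sum>i<r. w i \<bullet> x + c i) < (\<Sum>i<r. 0)" by (intro sum_strict_mono) auto
      then show False using w c by (simp add: sum.distrib flip: inner_sum_left)
    qed
    then obtain J where J: "J \<subseteq> {..<r}" "card J = DIM('a) + 1" "(\<Inter>i\<in>J. {x. w i \<bullet> x + c i < 0}) = {}"
      using Helly_indexed[of "{..<r}" "\<lambda>i. {x. w i \<bullet> x + c i < 0}"] r halfspace_convex by force
    define Z where "Z = (\<lambda>i\<in>{..<r}. X \<inter> {x. 0 \<le> w i \<bullet> x + c i})"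
    have "\<exists>i\<in>J. x \<in> Z i" if "x \<in> X" for x
    proof -
      obtain i where i: "i \<in> J" "\<not> w i \<bullet> x + c i < 0" using J(3) by blast
      then have "x \<in> Z i" using J(1) that by (auto simp: Z_def)
      then show ?thesis using i by blast
    qed
    moreover have "Z \<in> {..<r} \<rightarrow>\<^sub>E halfspace_traces X" by (auto simp: Z_def halfspace_traces_def)
    ultimately have "Z \<in> \<H>" unfolding \<H>_def using J(1,2) by blast
    have "{C\<in>F. \<sigma> C \<in> B Z C} \<subseteq> {C\<in>F. \<exists>i<r. 0 \<le> w i \<bullet> b C i + c i}"
      by (auto simp: B_def Z_def b_def)
    then have "card {C\<in>F. \<sigma> C \<in> B Z C} \<le> card {C\<in>F. \<exists>i<r. 0 \<le> w i \<bullet> b C i + c i}"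
      using finF by (intro card_mono) auto
    then show ?thesis using many[OF \<open>Z \<in> \<H>\<close>] cardF by simp
  qed
  have "tverberg (remove_classes S (A ` {..<r}))"
    if S: "S \<subseteq> F" "real (card S) \<le> q r DIM('a) * real N - \<epsilon>" for S
  proof (rule ccontr)
    assume not: "\<not> ?thesis"
    have avoid: "b C i \<in> A i - \<Union>S" if "C \<in> F" "C \<notin> S" "i < r" for C i
    proof -
      have "b C i \<in> C" using b[OF that(1)] that(3) by (auto simp: bij_betw_def)
      moreover have "C \<inter> C' = {}" if "C' \<in> S" for C'
      proof (rule disjointD)
        show "disjoint F" using F by (simp add: color_classes_def)
      qed (use that \<open>C \<in> F\<close> \<open>C \<notin> S\<close> S(1) in auto)
      ultimately show ?thesis using that(1) unfolding A_def by blast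
    qed
    \<comment> \<open>The zero functionals hit every class, so \<open>hits\<close> shows that
      \<open>S\<close> is smaller than \<open>F\<close>. A surviving class makes all the hulls
      nonempty, as separation demands.\<close>
    have "\<exists>C\<in>F. C \<notin> S"
    proof -
      have "real (card S) < real (card {C\<in>F. \<exists>i<r. 0 \<le> (0::'a) \<bullet> b C i + 0})"
        using hits[of "\<lambda>_. 0" "\<lambda>_. 0"] S(2) by simp
      also have "\<dots> \<le> real (card F)" using finF by (intro of_nat_mono card_mono) auto
      finally have "S \<noteq> F" by auto
      then show ?thesis using S(1) by blast
    qed
    then obtain C0 where C0: "C0 \<in> F" "C0 \<notin> S" by blast
    define K where "K i = convex hull (A i - \<Union>S)" for i
    have Kempty: "(\<Inter>i<r. K i) = {}"
      using not by (simp add: tverberg_def remove_classes_def K_def image_image)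
    obtain w c where w: "(\<Sum>i<r. w i) = 0" and c: "(\<Sum>i<r. c i) = 0"
      and neg: "\<And>i x. i < r \<Longrightarrow> x \<in> K i \<Longrightarrow> w i \<bullet> x + c i < 0"
    proof (rule strictly_separating_functionals[of "{..<r}" K])
      show "{..<r} \<noteq> {}" using r by (auto simp: lessThan_empty_iff)
      show "compact (K i)" for i
        unfolding K_def A_def using finF by (intro finite_imp_compact_convex_hull) auto
      show "convex (K i)" for i by (simp add: K_def)
      show "K i \<noteq> {}" if "i \<in> {..<r}" for i
        using avoid[OF C0] that unfolding K_def convex_hull_eq_empty by blast
    qed (use Kempty in auto)
    have "real (card S) < real (card {C\<in>F. \<exists>i<r. 0 \<le> w i \<bullet> b C i + c i})"
      using hits[OF w c] S(2) by linarith
    moreover have "{C\<in>F. \<exists>i<r. 0 \<le> w i \<bullet> b C i + c i} \<subseteq> S"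
    proof (rule subsetI, rule ccontr)
      fix C assume "C \<in> {C\<in>F. \<exists>i<r. 0 \<le> w i \<bullet> b C i + c i}" "C \<notin> S"
      then obtain i where i: "C \<in> F" "i < r" "0 \<le> w i \<bullet> b C i + c i" by blast
      have "b C i \<in> K i"
        unfolding K_def using avoid[OF i(1) \<open>C \<notin> S\<close> i(2)] by (rule hull_inc)
      then show False using neg[OF i(2)] i(3) by force
    qed
    then have "card {C\<in>F. \<exists>i<r. 0 \<le> w i \<bullet> b C i + c i} \<le> card S"
      by (rule card_mono[OF finite_subset[OF S(1) finF]])
    ultimately show False by linarith
  qed
  moreover have "colorful_partition r F (A ` {..<r})"
    unfolding A_def by (rule colorful_partition_of_bijections[OF F ne b])
  ultimately show ?thesis by blast
qed

section \<open>Choice of the deviation and the asymptotic estimate\<close>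

text \<open>From \<open>r + 1 \<le> 2 ^ r \<le> N ^ r\<close> one gets
  \<open>r * N + 1 \<le> N ^ (r + 1)\<close>, so \<open>K\<close> is chosen to bound the first
  factor by \<open>N ^ K\<close>. The deviation turns the exponential into the inverse of
  \<open>N ^ (2 * K)\<close>, which leaves at most the inverse of \<open>N ^ K\<close>.\<close>

lemma union_bound_small:
  fixes N r d K :: nat
  assumes N: "N \<ge> 2" and r: "r > 0" and K: "K = (r + 1) * ((d + 1) * r)"
  shows "real ((r * N + 1) ^ ((d + 1) * r)) *
    exp (- 2 * (sqrt (real K * (real N * ln (real N))))\<^sup>2 / real N) < 1"
proof -
  have "r * N + 1 \<le> (r + 1) * N" using N by simp
  also have "r + 1 \<le> 2 ^ r" using less_exp[of r] by linarith
  also have "2 ^ r \<le> N ^ r" using N by (intro power_mono) auto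
  finally have "r * N + 1 \<le> N ^ r * N" by simp
  then have "(r * N + 1) ^ ((d + 1) * r) \<le> (N ^ (r + 1)) ^ ((d + 1) * r)"
    by (intro power_mono) (auto simp: mult.commute)
  also have "\<dots> = N ^ K" unfolding K by (rule power_mult[symmetric])
  finally have "real ((r * N + 1) ^ ((d + 1) * r)) \<le> real (N ^ K)" by (rule of_nat_mono)
  also have "real (N ^ K) = exp (real K * ln (real N))"
    using N by (simp add: exp_of_nat_mult)
  finally have le: "real ((r * N + 1) ^ ((d + 1) * r)) \<le> exp (real K * ln (real N))" .
  have ln: "ln (real N) > 0" using N by simp
  have pos: "real K * ln (real N) > 0"
  proof -
    have "K > 0" using r by (simp add: K)
    then show ?thesis using ln by simp
  qed
  have exponent: "- 2 * (sqrt (real K * (real N * ln (real N))))\<^sup>2 / real N =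
      - 2 * (real K * ln (real N))"
    using ln N by (simp add: field_simps)
  have "real ((r * N + 1) ^ ((d + 1) * r)) * exp (- 2 * (real K * ln (real N))) \<le>
      exp (real K * ln (real N)) * exp (- 2 * (real K * ln (real N)))"
    using le by (rule mult_right_mono) simp
  also have "\<dots> = exp (- (real K * ln (real N)))" by (simp flip: exp_add)
  also have "\<dots> < 1" using pos by (simp only: exp_less_one_iff neg_less_0_iff_less)
  finally show ?thesis unfolding exponent .
qed

theorem theorem5p5:
  fixes r d :: nat
  assumes "r > 0" and "d > 0" and "CARD('n::finite) = d" and "r > d + 1"
  shows "\<exists>t :: nat \<Rightarrow> int.
           (\<lambda>N. q r d * real N - real_of_int (t N)) \<in> O(\<lambda>N. sqrt (real N * ln (real N))) \<and>
           (\<forall>N\<ge>1. t N \<le> int N \<and>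
              (\<forall>\<F> :: (real ^ 'n) set set. color_classes N r \<F> \<longrightarrow>
                 (\<exists>P. colorful_partition r \<F> P \<and>
                    (\<forall>S\<subseteq>\<F>. int (card S) = t N \<longrightarrow> tverberg (remove_classes S P)))))"
proof -
  define K where "K = (r + 1) * ((d + 1) * r)"
  define \<epsilon> where "\<epsilon> N = sqrt (real K * (real N * ln (real N)))" for N
  \<comment> \<open>A negative value makes the removal condition vacuous; at \<open>N = 1\<close> the union bound is useless as \<open>ln 1 = 0\<close>.\<close>
  define t where "t N = (if N < 2 then -1 else \<lfloor>q r d * real N - \<epsilon> N\<rfloor>)" for N :: nat
  have DIM: "DIM(real ^ 'n) = d" using assms(3) by simp
  have \<epsilon>0: "\<epsilon> N \<ge> 0" for N by (cases "N = 0") (auto simp: \<epsilon>_def)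
  have "(\<lambda>N. q r d * real N - real_of_int (t N)) \<in> O(\<lambda>N. sqrt (real N * ln (real N)))"
  \<comment> \<open>The term \<open>sqrt (real K)\<close> comes from \<open>\<epsilon>\<close> and
    the 1 from rounding down. From \<open>N = 3\<close> on, \<open>ln (real N)\<close> is at least
    1, so the rounding error is absorbed by the square root.\<close>
  proof (rule bigoI[of _ "sqrt (real K) + 1"], rule eventually_sequentiallyI[of 3])
    fix N :: nat assume N: "3 \<le> N"
    have "exp 1 \<le> real N" using N exp_le by linarith
    then have "1 \<le> ln (real N)" using N by (simp add: ln_ge_iff)
    then have "1 * 1 \<le> real N * ln (real N)" using N by (intro mult_mono) auto
    then have ge1: "1 \<le> sqrt (real N * ln (real N))" by simp
    have "q r d * real N - real_of_int (t N) \<le> \<epsilon> N + 1" "q r d * real N - real_of_int (t N) \<ge> 0"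
      using N \<epsilon>0[of N] by (auto simp: t_def) linarith+
    moreover have "\<epsilon> N = sqrt (real K) * sqrt (real N * ln (real N))"
      by (simp add: \<epsilon>_def real_sqrt_mult)
    ultimately show "norm (q r d * real N - real_of_int (t N)) \<le>
        (sqrt (real K) + 1) * norm (sqrt (real N * ln (real N)))"
      using ge1 by (simp add: distrib_right del: real_sqrt_ge_1_iff)
  qed
  moreover have "t N \<le> int N" for N
  proof -
    have "q r d * real N \<le> 1 * real N" using q_le_one[of d r] assms(4) by (intro mult_right_mono) auto
    then have "q r d * real N - \<epsilon> N \<le> real_of_int (int N)" using \<epsilon>0[of N] by simp
    then have "\<lfloor>q r d * real N - \<epsilon> N\<rfloor> \<le> int N" by (simp only: floor_le_iff)
    then show ?thesis by (simp add: t_def)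
  qed
  moreover have "\<exists>P. colorful_partition r \<F> P \<and>
      (\<forall>S\<subseteq>\<F>. int (card S) = t N \<longrightarrow> tverberg (remove_classes S P))"
    if N: "N \<ge> 1" and \<F>: "color_classes N r \<F>" for N and \<F> :: "(real ^ 'n) set set"
  proof (cases "N < 2")
    case True
    have ne: "\<F> \<noteq> {}" using N \<F> by (auto simp: color_classes_def)
    have "\<exists>f. bij_betw f {..<r} C" if "C \<in> \<F>" for C
      using \<F> that ex_bij_betw_nat_finite[of C] by (auto simp: lessThan_atLeast0 color_classes_def)
    then obtain e where e: "\<And>C. C \<in> \<F> \<Longrightarrow> bij_betw (e C) {..<r} C" by metis
    show ?thesis using colorful_partition_of_bijections[OF \<F> ne e] True by (auto simp: t_def)
  next
    case False
    have small: "real ((r * N + 1) ^ ((DIM(real ^ 'n) + 1) * r)) * exp (- 2 * (\<epsilon> N)\<^sup>2 / real N) < 1"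
      unfolding DIM \<epsilon>_def using False assms(1) by (intro union_bound_small[of N r K d]) (auto simp: K_def)
    have "DIM(real ^ 'n) + 1 \<le> r" using DIM assms(4) by simp
    then obtain P where P: "colorful_partition r \<F> P"
      "\<And>S. S \<subseteq> \<F> \<Longrightarrow> real (card S) \<le> q r DIM(real ^ 'n) * real N - \<epsilon> N \<Longrightarrow>
        tverberg (remove_classes S P)"
      using exists_tolerant_colorful_partition[OF \<F> N _ \<epsilon>0 small] by blast
    have "real (card S) \<le> q r d * real N - \<epsilon> N" if "int (card S) = t N" for S :: "(real ^ 'n) set set"
      using that False by (simp add: t_def) linarith
    then show ?thesis using P unfolding DIM by blast
  qed
  ultimately show ?thesis by blast
qed

end
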